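(* Let $d\ge 2$ be an integer and let $\pmb{\xi}=(\xi_1,\dots,\xi_d)\in\mathbb{R}^d$ be totally irrational (i.e. $1,\xi_1,\dots,\xi_d$ are linearly independent over $\mathbb{Z}$) with $\xi_1^2+\dots+\xi_d^2=1$. Then $\hat{\omega}(\pmb{\xi})\le H_{d-1}$, where $H_{d-1}$ is the unique positive root of $x^{d}+x^{d-1}+\dots+x=1$.
   Context: For $\Theta=(\theta_1,\dots,\theta_m)\in\mathbb{R}^m$, the uniform Diophantine exponent $\hat{\omega}(\Theta)$ is the supremum of all real $\gamma$ such that for every sufficiently large real $Q$ the system $\max_{1\le j\le m}|q\theta_j-a_j|<Q^{-\gamma}$, $1\le q\le Q$, has a solution $(q,a_1,\dots,a_m)\in\mathbb{Z}^{m+1}$. *)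

theory Defs
  imports Complex_Main "HOL-Library.Extended_Real"
begin

text \<open>Points of \<open>\<real>\<^sup>m\<close> are functions \<open>nat \<Rightarrow> real\<close>, of which only the values on \<open>{1..m}\<close> matter.\<close>

definition totally_irrational :: "nat \<Rightarrow> (nat \<Rightarrow> real) \<Rightarrow> bool" where
  "totally_irrational m \<theta> \<longleftrightarrow>
     (\<forall>(c :: int) (b :: nat \<Rightarrow> int).
        of_int c + (\<Sum>j=1..m. of_int (b j) * \<theta> j) = 0 \<longrightarrow> c = 0 \<and> (\<forall>j\<in>{1..m}. b j = 0))"

definition uniformly_approximable :: "nat \<Rightarrow> (nat \<Rightarrow> real) \<Rightarrow> real \<Rightarrow> bool" where
  "uniformly_approximable m \<theta> \<gamma> \<longleftrightarrow>
     (\<forall>\<^sub>F Q :: real in at_top. \<exists>(q :: int) (a :: nat \<Rightarrow> int).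
        1 \<le> q \<and> of_int q \<le> Q \<and>
        (MAX j\<in>{1..m}. \<bar>of_int q * \<theta> j - of_int (a j)\<bar>) < Q powr (- \<gamma>))"

text \<open>The supremum is taken in the extended reals, since the set of admissible exponents is
  unbounded for some points (for instance for rational ones). For \<open>m = 0\<close> the maximum above is
  over the empty set, so the notion is meaningful for \<open>m \<ge> 1\<close> only.\<close>

definition uniform_exponent :: "nat \<Rightarrow> (nat \<Rightarrow> real) \<Rightarrow> ereal" where
  "uniform_exponent m \<theta> = (SUP \<gamma>\<in>{\<gamma>. uniformly_approximable m \<theta> \<gamma>}. ereal \<gamma>)"

definition H :: "nat \<Rightarrow> real" where
  "H n = (THE x. 0 < x \<and> (\<Sum>k=1..n+1. x ^ k) = 1)"

lemma H_unique_root: "\<exists>!x::real. 0 < x \<and> (\<Sum>k=1..n+1. x ^ k) = 1"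
proof -
  let ?f = "\<lambda>x::real. \<Sum>k=1..n+1. x ^ k"
  have "?f 1 \<ge> 1" by simp
  moreover have "?f 0 = 0" by (simp add: power_0_left)
  moreover have "\<forall>x. 0 \<le> x \<and> x \<le> 1 \<longrightarrow> isCont ?f x" by (intro allI impI continuous_intros)
  ultimately obtain x where x: "0 \<le> x" "?f x = 1"
    using IVT[of ?f 0 1 1] by auto
  with \<open>?f 0 = 0\<close> have "0 < x" by (cases "x = 0") auto
  have mono: "?f y < ?f z" if "0 < y" "y < z" for y z
    by (rule sum_strict_mono) (use that in \<open>auto intro!: power_strict_mono\<close>)
  show ?thesis
  proof (rule ex1I[of _ x])
    show "0 < x \<and> ?f x = 1" using x \<open>0 < x\<close> by simp
    fix y assume y: "0 < y \<and> ?f y = 1"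
    show "y = x" using mono[of x y] mono[of y x] y x \<open>0 < x\<close> by (metis linorder_neqE less_irrefl)
  qed
qed

lemma H_root: "0 < H n" "(\<Sum>k=1..n+1. H n ^ k) = 1"
  unfolding H_def using theI'[OF H_unique_root[of n]] by blast+

end

theory Submission
  imports Defs "HOL-Library.Infinite_Set" "Jordan_Normal_Form.Determinant"
begin

text \<open>
  Let \<open>X i\<close> be the denominators and \<open>L i\<close> the errors of the best approximation vectors \<open>x i\<close>, and let
  \<open>\<gamma> < 1\<close> be a uniform exponent above the bound, so that \<open>\<gamma> > 1 / 2\<close> and \<open>L i \<le> C * X (i + 1) powr (- \<gamma>)\<close>
  for large \<open>i\<close>. If \<open>x (i + 1) = (Q, A)\<close> satisfies \<open>|A|\<^sup>2 = Q\<^sup>2\<close> and \<open>x i = (q, a)\<close>, then the positive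
  integer \<open>|qA - Qa|\<^sup>2\<close> is divisible by \<open>Q\<close>, so \<open>Q * (L i)\<^sup>2\<close> is bounded below, which is impossible for
  large \<open>i\<close>. Hence late best approximations \<open>(q, a)\<close> have \<open>|q\<^sup>2 - |a|\<^sup>2| \<ge> 1\<close>. This bounds
  \<open>X i * L i\<close> below, and so \<open>X (i + 1)\<close> is at most a constant times \<open>X i powr (1 / \<gamma>)\<close>.

  On the other hand, start at a late \<open>x s\<close> and let \<open>k 0 < k 1 < \<dots>\<close> be the indices \<open>k \<ge> s\<close> for which
  \<open>x (k + 1)\<close> is not in the span of \<open>x s, \<dots>, x k\<close>. The determinant of \<open>x s\<close> and the \<open>d\<close> vectors
  \<open>x (k j + 1)\<close> is a nonzero integer. Subtracting a multiple of the old vector \<open>x (k j)\<close> from each new vector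
  \<open>x (k j + 1)\<close> bounds it by a constant times \<open>X s\<close> times the product of the \<open>X (k j + 1) * L (k j) / X (k j)\<close>.
  After taking logarithms, a suitable combination with the growth bound contradicts
  \<open>\<gamma> + \<dots> + \<gamma>\<^sup>d > 1\<close>.
\<close>

section \<open>A linear inequality\<close>

text \<open>In the application \<open>y j\<close> and \<open>z j\<close> are the logarithms of consecutive denominators. Each \<open>z j\<close> is
  bounded by the convex combination of its two bounds with weights \<open>T j / T n\<close> and \<open>1 - T j / T n\<close>;
  since \<open>T (Suc j) / \<gamma> = 1 + T j\<close>, all \<open>y (Suc j)\<close> then get the same coefficient \<open>1 + T n\<close>.\<close>

lemma weighted_chain_bound:
  fixes y z :: "nat \<Rightarrow> real" and \<gamma> C :: real
  defines "T \<equiv> \<lambda>j. \<Sum>k<j. \<gamma> ^ Suc k"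
  assumes \<gamma>: "0 < \<gamma>" "\<gamma> < 1"
    and zy: "\<And>j. j < n \<Longrightarrow> z j \<le> y (Suc j)"
    and zmu: "\<And>j. j \<le> n \<Longrightarrow> \<gamma> * z j \<le> y j + C"
    and tot: "(\<Sum>j<n. y (Suc j)) \<le> (1 - \<gamma>) * (\<Sum>j<Suc n. z j) + C"
  shows "(T (Suc n) - 1) * (\<Sum>j<n. y (Suc j)) \<le> (1 - \<gamma>) * (\<Sum>j<Suc n. T j / \<gamma> * C) + T n * C"
proof -
  define Y where "Y = (\<Sum>j<n. y (Suc j))"
  have T0: "T 0 = 0" and Tpos: "0 \<le> T j" for j
    using \<gamma> by (auto simp: T_def intro!: sum_nonneg)
  have Tmono: "T j \<le> T n" if "j \<le> n" for j
    unfolding T_def by (rule sum_mono2) (use that \<gamma> in auto)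
  have TSuc: "T (Suc j) = \<gamma> * (1 + T j)" for j
    unfolding T_def by (subst sum.lessThan_Suc_shift) (simp add: sum_distrib_left algebra_simps)
  have step: "T n * z j \<le> T j / \<gamma> * y j + (T n - T j) * y (Suc j) + T j / \<gamma> * C" if "j < Suc n" for j
  proof -
    have "T j / \<gamma> * (\<gamma> * z j) \<le> T j / \<gamma> * (y j + C)"
      using that \<gamma> Tpos by (intro mult_left_mono zmu) auto
    \<comment> \<open>At \<open>j = n\<close> the weight \<open>T n - T j\<close> is zero, so
      \<open>y (Suc n)\<close>, on which there is no assumption, does no harm.\<close>
    moreover have "(T n - T j) * z j \<le> (T n - T j) * y (Suc j)"
      using that zy Tmono by (cases "j = n") (auto intro!: mult_left_mono)
    ultimately show ?thesis
      using \<gamma> by (simp only: distrib_left left_diff_distrib) simp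
  qed
  have "T n * (\<Sum>j<Suc n. z j) \<le> (\<Sum>j<Suc n. T j / \<gamma> * y j + (T n - T j) * y (Suc j) + T j / \<gamma> * C)"
    unfolding sum_distrib_left by (rule sum_mono) (use step in auto)
  also have "\<dots> = (\<Sum>j<Suc n. T j / \<gamma> * y j) + (\<Sum>j<Suc n. (T n - T j) * y (Suc j))
      + (\<Sum>j<Suc n. T j / \<gamma> * C)"
    by (simp only: sum.distrib)
  \<comment> \<open>The term with \<open>y 0\<close> drops out because
    \<open>T 0 = 0\<close>.\<close>
  also have "(\<Sum>j<Suc n. T j / \<gamma> * y j) = (\<Sum>j<n. (1 + T j) * y (Suc j))"
    using \<gamma> by (subst sum.lessThan_Suc_shift) (simp add: T0 TSuc)
  also have "(\<Sum>j<Suc n. (T n - T j) * y (Suc j)) = (\<Sum>j<n. (T n - T j) * y (Suc j))"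
    by simp
  also have "(\<Sum>j<n. (1 + T j) * y (Suc j)) + (\<Sum>j<n. (T n - T j) * y (Suc j)) = (1 + T n) * Y"
    unfolding Y_def sum_distrib_left sum.distrib[symmetric] by (rule sum.cong) (auto simp: algebra_simps)
  finally have 1: "T n * (\<Sum>j<Suc n. z j) \<le> (1 + T n) * Y + (\<Sum>j<Suc n. T j / \<gamma> * C)" .
  have "T n * Y \<le> T n * ((1 - \<gamma>) * (\<Sum>j<Suc n. z j) + C)"
    using tot Tpos unfolding Y_def by (intro mult_left_mono) auto
  also have "\<dots> = (1 - \<gamma>) * (T n * (\<Sum>j<Suc n. z j)) + T n * C"
    by (simp add: algebra_simps)
  also have "\<dots> \<le> (1 - \<gamma>) * ((1 + T n) * Y + (\<Sum>j<Suc n. T j / \<gamma> * C)) + T n * C"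
    using \<gamma> by (intro add_right_mono mult_left_mono 1) auto
  finally have "T n * Y - (1 - \<gamma>) * ((1 + T n) * Y) \<le> (1 - \<gamma>) * (\<Sum>j<Suc n. T j / \<gamma> * C) + T n * C"
    by (simp add: distrib_left)
  \<comment> \<open>The coefficient of \<open>Y\<close> is \<open>\<gamma> * (1 + T n) - 1\<close>,
    which is \<open>T (Suc n) - 1\<close> by the recursion.\<close>
  moreover have "T n * Y - (1 - \<gamma>) * ((1 + T n) * Y) = (T (Suc n) - 1) * Y"
    unfolding TSuc by (simp add: algebra_simps)
  ultimately show ?thesis unfolding Y_def by simp
qed

section \<open>Determinants along chains of spans\<close>

text \<open>The coefficients are real because they become entries of a real matrix of row operations
  in \<open>chain_det_bound\<close>.\<close>

definition in_span :: "nat \<Rightarrow> (nat \<Rightarrow> nat \<Rightarrow> int) \<Rightarrow> nat \<Rightarrow> (nat \<Rightarrow> int) \<Rightarrow> bool" where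
  "in_span N v j u \<longleftrightarrow>
     (\<exists>c :: nat \<Rightarrow> real. \<forall>l<N. of_int (u l) = (\<Sum>i\<le>j. c i * of_int (v i l)))"

lemma in_span_member:
  assumes "i \<le> j"
  shows "in_span N v j (v i)"
proof -
  have "(\<Sum>k\<le>j. (if k = i then 1 else 0) * real_of_int (v k l)) = (\<Sum>k\<le>j. if k = i then of_int (v k l) else 0)" for l
    by (rule sum.cong) auto
  then show ?thesis
    unfolding in_span_def using assms by (intro exI[of _ "\<lambda>k. if k = i then 1 else 0"]) simp
qed

lemma in_span_cong: "(\<And>i. i \<le> j \<Longrightarrow> v i = w i) \<Longrightarrow> in_span N v j u = in_span N w j u"
  unfolding in_span_def by simp

text \<open>Padding the \<open>n + 1\<close> vectors with zero rows gives a singular square matrix,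
  and a singular matrix over the integers already has a nonzero integer kernel vector.\<close>

lemma annihilator_exists:
  fixes v :: "nat \<Rightarrow> nat \<Rightarrow> int"
  assumes "Suc n < N"
  shows "\<exists>c. (\<exists>l<N. c l \<noteq> 0) \<and> (\<forall>i\<le>n. (\<Sum>l<N. c l * v i l) = 0)"
proof -
  define A where "A = mat N N (\<lambda>(i, l). if i \<le> n then v i l else 0)"
  have A: "A \<in> carrier_mat N N" by (simp add: A_def)
  have "transpose_mat A *\<^sub>v unit_vec N (N - 1) = 0\<^sub>v N"
    using assms by (intro eq_vecI) (auto simp: A_def)
  then have "det (transpose_mat A) = 0"
    using assms A by (subst det_0_iff_vec_prod_zero[of _ N]) (auto intro!: exI[of _ "unit_vec N (N - 1)"])
  then have "det A = 0" using det_transpose[OF A] by simp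
  then obtain u where u: "u \<in> carrier_vec N" "u \<noteq> 0\<^sub>v N" "A *\<^sub>v u = 0\<^sub>v N"
    using det_0_iff_vec_prod_zero[OF A] by auto
  have "(\<Sum>l<N. u $ l * v i l) = 0" if "i \<le> n" for i
  proof -
    have "(A *\<^sub>v u) $ i = 0" using u(3) that assms by simp
    moreover have "(A *\<^sub>v u) $ i = (\<Sum>l<N. u $ l * v i l)"
      using that assms u(1)
      by (auto simp: A_def scalar_prod_def mult.commute atLeast0LessThan intro!: sum.cong)
    ultimately show ?thesis by simp
  qed
  moreover have "\<exists>l<N. u $ l \<noteq> 0"
    using u(1,2) by (metis carrier_vecD eq_vecI index_zero_vec)
  ultimately show ?thesis by (intro exI[of _ "\<lambda>l. u $ l"]) auto
qed

text \<open>The chain is built greedily. While fewer than \<open>N\<close> vectors are chosen, some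
  nonzero integer form kills their span; by \<open>spanning\<close> it cannot kill all later
  \<open>x i\<close>, so the span is left eventually. Taking the first index after
  \<open>m n\<close> where this happens keeps its predecessor in the span, which is what the
  determinant estimate needs.\<close>

lemma span_chain_exists:
  fixes x :: "nat \<Rightarrow> nat \<Rightarrow> int"
  assumes spanning: "\<And>c i0. \<forall>i\<ge>i0. (\<Sum>l<N. c l * x i l) = 0 \<Longrightarrow> \<forall>l<N. c l = 0"
    and "n < N"
  shows "\<exists>m. m 0 = s \<and> (\<forall>j<n. m j < m (Suc j) \<and> \<not> in_span N (x \<circ> m) j (x (m (Suc j)))
           \<and> in_span N (x \<circ> m) j (x (m (Suc j) - 1)))"
  using \<open>n < N\<close>
proof (induction n)
  case 0
  show ?case by (rule exI[of _ "\<lambda>_. s"]) simp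
next
  case (Suc n)
  from Suc.IH[OF Suc_lessD[OF Suc.prems]] obtain m where m: "m 0 = s" "\<And>j. j < n \<Longrightarrow> m j < m (Suc j) \<and>
      \<not> in_span N (x \<circ> m) j (x (m (Suc j))) \<and> in_span N (x \<circ> m) j (x (m (Suc j) - 1))"
    by blast
  obtain c where c: "\<exists>l<N. c l \<noteq> 0" "\<And>i. i \<le> n \<Longrightarrow> (\<Sum>l<N. c l * (x \<circ> m) i l) = 0"
    using annihilator_exists[OF Suc.prems, of "x \<circ> m"] by blast
  have ann: "(\<Sum>l<N. c l * x i l) = 0" if span: "in_span N (x \<circ> m) n (x i)" for i
  proof -
    obtain b where b: "\<forall>l<N. of_int (x i l) = (\<Sum>k\<le>n. b k * of_int ((x \<circ> m) k l) :: real)"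
      using span unfolding in_span_def by blast
    have "real_of_int (\<Sum>l<N. c l * x i l) = (\<Sum>l<N. \<Sum>k\<le>n. b k * (of_int (c l) * of_int ((x \<circ> m) k l)))"
      using b by (auto simp: sum_distrib_left algebra_simps intro!: sum.cong)
    also have "\<dots> = (\<Sum>k\<le>n. b k * of_int (\<Sum>l<N. c l * (x \<circ> m) k l))"
      by (subst sum.swap) (simp add: sum_distrib_left)
    also have "\<dots> = 0" using c(2) by (intro sum.neutral) auto
    finally show ?thesis by (simp only: of_int_eq_0_iff)
  qed
  have "\<exists>i>m n. \<not> in_span N (x \<circ> m) n (x i)"
  proof (rule ccontr)
    assume "\<not> ?thesis"
    then have "\<forall>i\<ge>Suc (m n). (\<Sum>l<N. c l * x i l) = 0" using ann by auto
    from spanning[OF this] c(1) show False by blast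
  qed
  then obtain i where i: "m n < i" "\<not> in_span N (x \<circ> m) n (x i)"
    and least: "\<And>k. k < i \<Longrightarrow> \<not> (m n < k \<and> \<not> in_span N (x \<circ> m) n (x k))"
    using exists_least_iff[of "\<lambda>i. m n < i \<and> \<not> in_span N (x \<circ> m) n (x i)"] by auto
  have pred: "in_span N (x \<circ> m) n (x (i - 1))"
  proof (cases "i - 1 = m n")
    case True
    then show ?thesis using in_span_member[of n n N "x \<circ> m"] by simp
  next
    case False
    then show ?thesis using least[of "i - 1"] i(1) by auto
  qed
  define m' where "m' = m(Suc n := i)"
  have m': "m' (Suc n) = i" "\<And>j. j \<le> n \<Longrightarrow> m' j = m j" by (auto simp: m'_def)
  have cong: "in_span N (x \<circ> m') j u = in_span N (x \<circ> m) j u" if "j \<le> n" for j u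
    using that by (intro in_span_cong) (auto simp: m')
  have "m' j < m' (Suc j) \<and> \<not> in_span N (x \<circ> m') j (x (m' (Suc j)))
      \<and> in_span N (x \<circ> m') j (x (m' (Suc j) - 1))" if "j < Suc n" for j
    using m(2)[of j] i pred that by (cases "j = n") (simp_all add: m' cong)
  moreover have "m' 0 = s" using m(1) m'(2)[of 0] by simp
  ultimately show ?case by blast
qed

text \<open>In a nontrivial relation between the rows, the last row with a nonzero coefficient lies
  in the span of the earlier ones, or vanishes if it is row 0.\<close>

lemma det_chain_nonzero:
  assumes "\<exists>l<N. v 0 l \<noteq> 0"
    and new: "\<And>j. Suc j < N \<Longrightarrow> \<not> in_span N v j (v (Suc j))"
  shows "det (mat N N (\<lambda>(i, l). v i l)) \<noteq> 0"
proof
  let ?A = "mat N N (\<lambda>(i, l). v i l)"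
  have A: "?A \<in> carrier_mat N N" by simp
  assume "det ?A = 0"
  then have "det (transpose_mat ?A) = 0" using det_transpose[OF A] by simp
  then obtain u where u: "u \<in> carrier_vec N" "u \<noteq> 0\<^sub>v N" "transpose_mat ?A *\<^sub>v u = 0\<^sub>v N"
    using det_0_iff_vec_prod_zero[of "transpose_mat ?A" N] by auto
  have rel: "(\<Sum>i<N. u $ i * v i l) = 0" if "l < N" for l
  proof -
    have "(transpose_mat ?A *\<^sub>v u) $ l = 0" using u(3) that by simp
    moreover have "(transpose_mat ?A *\<^sub>v u) $ l = (\<Sum>i<N. u $ i * v i l)"
      using that u(1)
      by (auto simp: scalar_prod_def mult.commute atLeast0LessThan intro!: sum.cong)
    ultimately show ?thesis by simp
  qed
  define S where "S = {i. i < N \<and> u $ i \<noteq> 0}"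
  have "S \<noteq> {}" using u(1,2) unfolding S_def by (auto intro!: eq_vecI)
  moreover have "finite S" by (simp add: S_def)
  ultimately have M: "Max S \<in> S" and above: "\<And>i. i \<in> S \<Longrightarrow> i \<le> Max S" by auto
  define k where "k = Max S"
  have k: "k < N" "u $ k \<noteq> 0" using M by (auto simp: S_def k_def)
  have zero: "u $ i = 0" if "k < i" "i < N" for i
  proof (rule ccontr)
    assume "u $ i \<noteq> 0"
    with that have "i \<in> S" by (simp add: S_def)
    from above[OF this] that show False by (simp add: k_def)
  qed
  have rel': "(\<Sum>i<k. u $ i * v i l) + u $ k * v k l = 0" if "l < N" for l
  proof -
    have "(\<Sum>i<N. u $ i * v i l) = (\<Sum>i<Suc k. u $ i * v i l)"
      using k zero by (intro sum.mono_neutral_right) auto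
    then show ?thesis using rel[OF that] by simp
  qed
  show False
  proof (cases k)
    case 0
    then show False using rel' k assms(1) by auto
  next
    case (Suc j)
    have "in_span N v j (v k)"
      unfolding in_span_def
    proof (intro exI[of _ "\<lambda>i. - of_int (u $ i) / of_int (u $ k)"] allI impI)
      fix l assume l: "l < N"
      have "real_of_int (u $ k) * of_int (v k l) = - (\<Sum>i\<le>j. of_int (u $ i) * of_int (v i l))"
        using arg_cong[OF rel'[OF l], of real_of_int] Suc by (simp add: lessThan_Suc_atMost)
      then have "real_of_int (v k l) = - (\<Sum>i\<le>j. of_int (u $ i) * of_int (v i l)) / of_int (u $ k)"
        using k(2) by (simp add: field_simps)
      then show "real_of_int (v k l) = (\<Sum>i\<le>j. - of_int (u $ i) / of_int (u $ k) * of_int (v i l))"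
        by (simp add: sum_divide_distrib sum_negf)
    qed
    then show False using new[of j] Suc k(1) by simp
  qed
qed

text \<open>Each of the \<open>fact N\<close> products in the Leibniz expansion takes one entry from
  every row.\<close>

lemma abs_det_le:
  fixes A :: "real mat"
  assumes A: "A \<in> carrier_mat N N"
    and B: "\<And>i l. i < N \<Longrightarrow> l < N \<Longrightarrow> \<bar>A $$ (i, l)\<bar> \<le> B i"
  shows "\<bar>det A\<bar> \<le> fact N * (\<Prod>i<N. B i)"
proof -
  have "\<bar>det A\<bar> \<le> (\<Sum>p | p permutes {0..<N}. \<bar>signof p * (\<Prod>i = 0..<N. A $$ (i, p i))\<bar>)"
    unfolding det_def'[OF A] by (rule sum_abs)
  also have "\<dots> \<le> (\<Sum>p | p permutes {0..<N}. \<Prod>i<N. B i)"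
  proof (rule sum_mono)
    fix p assume "p \<in> {p. p permutes {0..<N}}"
    then have p: "p permutes {0..<N}" by simp
    have "\<bar>signof p * (\<Prod>i = 0..<N. A $$ (i, p i))\<bar> = (\<Prod>i<N. \<bar>A $$ (i, p i)\<bar>)"
      by (auto simp: abs_mult sign_def abs_prod atLeast0LessThan)
    also have "\<dots> \<le> (\<Prod>i<N. B i)"
      using p by (intro prod_mono) (auto intro!: B dest: permutes_in_image simp: atLeast0LessThan)
    finally show "\<bar>signof p * (\<Prod>i = 0..<N. A $$ (i, p i))\<bar> \<le> (\<Prod>i<N. B i)" .
  qed
  also have "\<dots> = fact N * (\<Prod>i<N. B i)"
    using card_permutations[of "{0..<N}" N] by simp
  finally show ?thesis .
qed

text \<open>Subtracting from each row a real combination of the preceding ones keeps the determinant,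
  so the nonzero integer determinant is bounded through the reduced rows \<open>v (Suc j) - t j \<cdot> u j\<close>.\<close>

lemma chain_det_bound:
  fixes v u :: "nat \<Rightarrow> nat \<Rightarrow> int" and t B :: "nat \<Rightarrow> real"
  assumes "\<exists>l\<le>n. v 0 l \<noteq> 0"
    and new: "\<And>j. j < n \<Longrightarrow> \<not> in_span (Suc n) v j (v (Suc j))"
    and old: "\<And>j. j < n \<Longrightarrow> in_span (Suc n) v j (u j)"
    and B0: "\<And>l. l \<le> n \<Longrightarrow> \<bar>of_int (v 0 l)\<bar> \<le> B 0"
    and BS: "\<And>j l. j < n \<Longrightarrow> l \<le> n \<Longrightarrow> \<bar>of_int (v (Suc j) l) - t j * of_int (u j l)\<bar> \<le> B (Suc j)"
  shows "1 \<le> fact (Suc n) * (\<Prod>i<Suc n. B i)"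
proof -
  let ?N = "Suc n"
  define V where "V = mat ?N ?N (\<lambda>(i, l). v i l)"
  define VR where "VR = map_mat real_of_int V"
  have "\<forall>j<n. \<exists>c :: nat \<Rightarrow> real. \<forall>l<?N. of_int (u j l) = (\<Sum>i\<le>j. c i * of_int (v i l))"
    using old unfolding in_span_def by blast
  then obtain c :: "nat \<Rightarrow> nat \<Rightarrow> real" where
    c: "\<And>j l. j < n \<Longrightarrow> l < ?N \<Longrightarrow> of_int (u j l) = (\<Sum>i\<le>j. c j i * of_int (v i l))"
    by metis
  \<comment> \<open>The row operations as a unit lower triangular matrix: row \<open>Suc j\<close>
    of \<open>U * VR\<close> is \<open>v (Suc j) - t j * u j\<close>, with \<open>u j\<close>
    expanded in the earlier rows.\<close>
  define U where "U = mat ?N ?N (\<lambda>(i, k). if k = i then 1 else if k < i then - t (i - 1) * c (i - 1) k else 0)"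
  have carr: "V \<in> carrier_mat ?N ?N" "VR \<in> carrier_mat ?N ?N" "U \<in> carrier_mat ?N ?N"
    by (auto simp: V_def VR_def U_def)
  have "det U = prod_list (diag_mat U)"
    by (rule det_lower_triangular[OF _ carr(3)]) (auto simp: U_def)
  also have "\<dots> = 1" unfolding prod_list_diag_prod by (rule prod.neutral) (auto simp: U_def)
  finally have "det (U * VR) = det VR" using det_mult[OF carr(3,2)] by simp
  moreover have "det VR = of_int (det V)" unfolding VR_def by simp
  moreover have "det V \<noteq> 0"
    unfolding V_def by (rule det_chain_nonzero) (use assms(1) new in \<open>auto simp: less_Suc_eq_le\<close>)
  ultimately have "1 \<le> \<bar>det (U * VR)\<bar>" by simp
  also have "\<dots> \<le> fact ?N * (\<Prod>i<?N. B i)"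
  proof (rule abs_det_le)
    show "U * VR \<in> carrier_mat ?N ?N" using carr by simp
    fix i l assume il: "i < ?N" "l < ?N"
    have "(U * VR) $$ (i, l) = (\<Sum>k<?N. U $$ (i, k) * VR $$ (k, l))"
      using il carr by (simp add: scalar_prod_def atLeast0LessThan)
    also have "\<dots> = (\<Sum>k<?N. (if k = i then 1 else if k < i then - t (i - 1) * c (i - 1) k else 0) * of_int (v k l))"
      using il by (intro sum.cong) (auto simp: U_def VR_def V_def)
    also have "\<dots> = (\<Sum>k\<le>i. (if k = i then 1 else if k < i then - t (i - 1) * c (i - 1) k else 0) * of_int (v k l))"
      using il by (intro sum.mono_neutral_right) auto
    finally have entry: "(U * VR) $$ (i, l) = \<dots>" .
    show "\<bar>(U * VR) $$ (i, l)\<bar> \<le> B i"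
    proof (cases i)
      case 0
      then show ?thesis using entry B0[of l] il by simp
    next
      case (Suc j)
      have "(U * VR) $$ (i, l) = of_int (v (Suc j) l) + (\<Sum>k\<le>j. - t j * c j k * of_int (v k l))"
        unfolding entry unfolding Suc by (auto intro!: sum.cong)
      also have "\<dots> = of_int (v (Suc j) l) - t j * of_int (u j l)"
        using c[of j l] il Suc by (simp add: sum_distrib_left sum_negf algebra_simps)
      finally show ?thesis using BS[of j l] il Suc by simp
    qed
  qed
  finally show ?thesis .
qed

section \<open>Best approximations\<close>

lemma uniformly_approximable_mono:
  assumes "uniformly_approximable m \<theta> \<gamma>" "\<gamma>' \<le> \<gamma>"
  shows "uniformly_approximable m \<theta> \<gamma>'"
  using assms(1) eventually_ge_at_top[of 1] unfolding uniformly_approximable_def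
proof eventually_elim
  case (elim Q)
  moreover have "Q powr (- \<gamma>) \<le> Q powr (- \<gamma>')" using elim(2) assms(2) by (intro powr_mono) auto
  ultimately show ?case by (meson less_le_trans)
qed

text \<open>The distance from \<open>q * \<theta>\<close> to the integer lattice in the maximum
  norm, since rounding is optimal in each coordinate.\<close>

definition approx_err :: "nat \<Rightarrow> (nat \<Rightarrow> real) \<Rightarrow> nat \<Rightarrow> real" where
  "approx_err m \<theta> q = (MAX j\<in>{1..m}. \<bar>real q * \<theta> j - of_int (round (real q * \<theta> j))\<bar>)"

lemma approx_err_ge:
  "j \<in> {1..m} \<Longrightarrow> \<bar>real q * \<theta> j - of_int (round (real q * \<theta> j))\<bar> \<le> approx_err m \<theta> q"
  unfolding approx_err_def by (intro Max_ge) auto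

lemma approx_err_le:
  assumes "1 \<le> m"
  shows "approx_err m \<theta> q \<le> (MAX j\<in>{1..m}. \<bar>real q * \<theta> j - of_int (a j)\<bar>)"
proof -
  have "\<bar>real q * \<theta> j - of_int (round (real q * \<theta> j))\<bar> \<le> (MAX j\<in>{1..m}. \<bar>real q * \<theta> j - of_int (a j)\<bar>)"
    if "j \<in> {1..m}" for j
    using round_diff_minimal[of "real q * \<theta> j" "a j"] Max_ge[of "(\<lambda>j. \<bar>real q * \<theta> j - of_int (a j)\<bar>) ` {1..m}"] that
    by (meson finite_atLeastAtMost finite_imageI imageI order_trans)
  then show ?thesis unfolding approx_err_def using assms by (subst Max_le_iff) auto
qed

lemma approx_err_le_half:
  assumes "1 \<le> m"
  shows "approx_err m \<theta> q \<le> 1 / 2"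
proof -
  have "\<bar>real q * \<theta> j - of_int (round (real q * \<theta> j))\<bar> \<le> 1 / 2" for j
    using of_int_round_abs_le[of "real q * \<theta> j"] by (simp add: abs_minus_commute)
  then show ?thesis unfolding approx_err_def using assms by (subst Max_le_iff) auto
qed

lemma approx_err_pos:
  assumes irr: "totally_irrational m \<theta>" and "1 \<le> m" "1 \<le> q"
  shows "0 < approx_err m \<theta> q"
proof -
  have "real q * \<theta> 1 \<noteq> of_int (round (real q * \<theta> 1))"
  proof
    assume *: "real q * \<theta> 1 = of_int (round (real q * \<theta> 1))"
    let ?b = "\<lambda>j::nat. if j = 1 then int q else 0"
    have "(\<Sum>j=1..m. of_int (?b j) * \<theta> j) = (\<Sum>j=1..m. if j = 1 then real q * \<theta> j else 0)"
      by (rule sum.cong) auto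
    also have "\<dots> = real q * \<theta> 1" using \<open>1 \<le> m\<close> by simp
    finally have "of_int (- round (real q * \<theta> 1)) + (\<Sum>j=1..m. of_int (?b j) * \<theta> j) = 0" using * by simp
    from irr[unfolded totally_irrational_def, rule_format, OF this] have "\<forall>j\<in>{1..m}. ?b j = 0" ..
    from bspec[OF this, of 1] have "int q = 0" using \<open>1 \<le> m\<close> by simp
    then show False using \<open>1 \<le> q\<close> by simp
  qed
  then have "0 < \<bar>real q * \<theta> 1 - of_int (round (real q * \<theta> 1))\<bar>" by simp
  also have "\<dots> \<le> approx_err m \<theta> q" using \<open>1 \<le> m\<close> by (intro approx_err_ge) auto
  finally show ?thesis .
qed

lemma uniformly_approximable_nat:
  assumes "uniformly_approximable m \<theta> \<gamma>" "1 \<le> m"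
  shows "\<forall>\<^sub>F Q in at_top. \<exists>q::nat. 1 \<le> q \<and> real q \<le> Q \<and> approx_err m \<theta> q < Q powr (- \<gamma>)"
  using assms(1) unfolding uniformly_approximable_def
proof eventually_elim
  case (elim Q)
  then obtain q :: int and a where q: "1 \<le> q" "of_int q \<le> Q"
    "(MAX j\<in>{1..m}. \<bar>of_int q * \<theta> j - of_int (a j)\<bar>) < Q powr (- \<gamma>)" by blast
  then have "real (nat q) = of_int q" by simp
  then show ?case using q approx_err_le[OF assms(2), of \<theta> "nat q" a]
    by (intro exI[of _ "nat q"]) auto
qed

definition best_denoms :: "nat \<Rightarrow> (nat \<Rightarrow> real) \<Rightarrow> nat set" where
  "best_denoms m \<theta> = {q. 1 \<le> q \<and> (\<forall>p. 1 \<le> p \<and> p < q \<longrightarrow> approx_err m \<theta> q < approx_err m \<theta> p)}"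

text \<open>The least denominator with error below \<open>\<epsilon>\<close> beats all smaller ones,
  so it is a best one.\<close>

lemma best_denom_below:
  assumes "1 \<le> q" "approx_err m \<theta> q < \<epsilon>"
  obtains p where "p \<in> best_denoms m \<theta>" "p \<le> q" "approx_err m \<theta> p < \<epsilon>"
proof -
  define p where "p = (LEAST p. 1 \<le> p \<and> approx_err m \<theta> p < \<epsilon>)"
  have p: "1 \<le> p" "approx_err m \<theta> p < \<epsilon>" "p \<le> q"
    using LeastI[of "\<lambda>p. 1 \<le> p \<and> approx_err m \<theta> p < \<epsilon>" q] assms
      Least_le[of "\<lambda>p. 1 \<le> p \<and> approx_err m \<theta> p < \<epsilon>" q] by (auto simp: p_def)
  have "\<epsilon> \<le> approx_err m \<theta> p'" if "1 \<le> p'" "p' < p" for p'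
    using not_less_Least[of p' "\<lambda>p. 1 \<le> p \<and> approx_err m \<theta> p < \<epsilon>"] that by (auto simp: p_def)
  then have "p \<in> best_denoms m \<theta>" using p unfolding best_denoms_def by force
  with p that show ?thesis by blast
qed

section \<open>The sequence of best approximations of a totally irrational point\<close>

locale uniform_point =
  fixes m :: nat and \<theta> :: "nat \<Rightarrow> real" and \<gamma> :: real
  assumes m_pos: "1 \<le> m" and irrational: "totally_irrational m \<theta>"
    and uniform: "uniformly_approximable m \<theta> \<gamma>" and \<gamma>_pos: "0 < \<gamma>"
begin

abbreviation err :: "nat \<Rightarrow> real" where "err \<equiv> approx_err m \<theta>"

lemma err_small:
  assumes "0 < \<epsilon>"
  obtains q where "1 \<le> q" "err q < \<epsilon>"
proof -
  have "((\<lambda>Q. Q powr (- \<gamma>)) \<longlongrightarrow> 0) at_top"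
    using \<gamma>_pos by (intro tendsto_neg_powr filterlim_ident) auto
  then have "\<forall>\<^sub>F Q in at_top. Q powr (- \<gamma>) < \<epsilon>" using assms by (rule order_tendstoD)
  from eventually_conj[OF uniformly_approximable_nat[OF uniform m_pos] this]
  obtain Q where Q: "\<exists>q::nat. 1 \<le> q \<and> real q \<le> Q \<and> err q < Q powr (- \<gamma>)" "Q powr (- \<gamma>) < \<epsilon>"
    using eventually_happens trivial_limit_at_top_linorder by blast
  then show ?thesis using that less_trans by blast
qed

lemma infinite_best_denoms: "infinite (best_denoms m \<theta>)"
proof
  assume fin: "finite (best_denoms m \<theta>)"
  \<comment> \<open>The extra element 1 keeps the set nonempty, so that its minimum makes
    sense.\<close>
  define E where "E = insert 1 (err ` best_denoms m \<theta>)"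
  have E: "finite E" "E \<noteq> {}" using fin by (auto simp: E_def)
  have "0 < Min E"
    using E irrational m_pos by (subst Min_gr_iff) (auto simp: E_def best_denoms_def intro!: approx_err_pos)
  then obtain q where q: "1 \<le> q" "err q < Min E" by (rule err_small)
  then obtain p where "p \<in> best_denoms m \<theta>" "err p < Min E" by (rule best_denom_below)
  then show False using E(1) Min_le[of E "err p"] by (auto simp: E_def)
qed

definition X :: "nat \<Rightarrow> nat" where "X = enumerate (best_denoms m \<theta>)"

lemma X_mem: "X i \<in> best_denoms m \<theta>"
  unfolding X_def by (rule enumerate_in_set[OF infinite_best_denoms])

lemma X_pos: "1 \<le> X i"
  using X_mem[of i] by (simp add: best_denoms_def)

lemma X_strict_mono: "i < j \<Longrightarrow> X i < X j"
  unfolding X_def by (rule enumerate_mono[OF _ infinite_best_denoms])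

lemma X_mono: "i \<le> j \<Longrightarrow> X i \<le> X j"
  using X_strict_mono by (metis le_eq_less_or_eq)

lemma X_ge: "i \<le> X i"
  unfolding X_def by (rule le_enumerate[OF infinite_best_denoms])

lemma err_X_pos: "0 < err (X i)"
  by (rule approx_err_pos[OF irrational m_pos X_pos])

lemma err_X_less: "i < j \<Longrightarrow> err (X j) < err (X i)"
  using X_mem[of j] X_pos[of i] X_strict_mono by (auto simp: best_denoms_def)

text \<open>A better \<open>q\<close> would yield a best denominator below \<open>X (Suc i)\<close>
  with error less than \<open>err (X i)\<close>; its index is at most \<open>i\<close>, but errors
  decrease along the sequence.\<close>

lemma err_X_minimal:
  assumes "1 \<le> q" "q < X (Suc i)"
  shows "err (X i) \<le> err q"
proof (rule ccontr)
  assume "\<not> ?thesis"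
  with best_denom_below[OF assms(1), of m \<theta> "err (X i)"] obtain p
    where p: "p \<in> best_denoms m \<theta>" "p \<le> q" "err p < err (X i)" by auto
  obtain k where k: "p = X k"
    using enumerate_Ex[OF infinite_best_denoms p(1)] by (auto simp: X_def)
  have "X k < X (Suc i)" using k p(2) assms(2) by simp
  then have "k \<le> i" using X_mono[of "Suc i" k] by (meson leD not_less_eq_eq)
  then show False using err_X_less[of k i] p(3) k by (cases "k = i") auto
qed

lemma err_X_bound: "\<forall>\<^sub>F i in sequentially. err (X i) \<le> 2 powr \<gamma> * real (X (Suc i)) powr (- \<gamma>)"
proof -
  \<comment> \<open>The shift by 1/2 forces the solution \<open>q\<close> strictly below
    \<open>X (Suc i)\<close>, where \<open>err_X_minimal\<close> applies. The shifted value is still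
    at least half of \<open>X (Suc i)\<close>, which costs the factor
    \<open>2 powr \<gamma>\<close>.\<close>
  have "filterlim (\<lambda>i. real (X (Suc i)) - 1 / 2) at_top sequentially"
  proof (rule filterlim_at_top_mono[OF filterlim_real_sequentially], rule always_eventually, rule allI)
    fix i show "real i \<le> real (X (Suc i)) - 1 / 2" using X_ge[of "Suc i"] by linarith
  qed
  from eventually_compose_filterlim[OF uniformly_approximable_nat[OF uniform m_pos] this]
  show ?thesis
  proof eventually_elim
    case (elim i)
    let ?Q = "real (X (Suc i)) - 1 / 2"
    obtain q :: nat where q: "1 \<le> q" "real q \<le> ?Q" "err q < ?Q powr (- \<gamma>)" using elim by blast
    have "err (X i) \<le> err q" by (rule err_X_minimal) (use q in linarith)+
    also have "\<dots> \<le> ?Q powr (- \<gamma>)" using q by simp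
    also have "\<dots> \<le> (real (X (Suc i)) / 2) powr (- \<gamma>)"
      using X_pos[of "Suc i"] \<gamma>_pos by (intro powr_mono2') auto
    also have "\<dots> = 2 powr \<gamma> * real (X (Suc i)) powr (- \<gamma>)"
      by (simp add: powr_divide powr_minus divide_simps)
    finally show ?case .
  qed
qed

definition best :: "nat \<Rightarrow> nat \<Rightarrow> int" where
  "best i l = (if l = 0 then int (X i) else round (real (X i) * \<theta> l))"

lemma best_err: "l \<in> {1..m} \<Longrightarrow> \<bar>real (X i) * \<theta> l - of_int (best i l)\<bar> \<le> err (X i)"
  using approx_err_ge[of l m "X i" \<theta>] by (simp add: best_def)

text \<open>Every tail of the sequence spans the whole space: if a form vanishes on it, the value at
  \<open>(1, \<theta>)\<close> times \<open>X i\<close> stays bounded. As \<open>X i\<close> is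
  unbounded this value is zero, and total irrationality kills the coefficients.\<close>

lemma best_spanning:
  assumes "\<forall>i\<ge>i0. (\<Sum>l<Suc m. c l * best i l) = 0"
  shows "\<forall>l<Suc m. c l = 0"
proof -
  let ?S = "of_int (c 0) + (\<Sum>l=1..m. of_int (c l) * \<theta> l)"
  let ?K = "\<Sum>l=1..m. \<bar>real_of_int (c l)\<bar>"
  have bound: "real i * \<bar>?S\<bar> \<le> ?K" if "i0 \<le> i" for i
  proof -
    have split: "(\<Sum>l<Suc m. f l) = f 0 + (\<Sum>l=1..m. f l)" for f :: "nat \<Rightarrow> int"
      unfolding lessThan_Suc_atMost atMost_atLeast0 by (subst sum.atLeast_Suc_atMost) auto
    have "real_of_int (c 0 * best i 0 + (\<Sum>l=1..m. c l * best i l)) = 0"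
      using assms that unfolding split by simp
    then have "of_int (c 0) * real (X i) + (\<Sum>l=1..m. of_int (c l) * real_of_int (best i l)) = 0"
      by (simp add: best_def)
    then have "?S * real (X i) = (\<Sum>l=1..m. of_int (c l) * (real (X i) * \<theta> l - of_int (best i l)))"
      by (simp add: algebra_simps sum_subtractf sum_distrib_left)
    also have "\<bar>\<dots>\<bar> \<le> (\<Sum>l=1..m. \<bar>of_int (c l) * (real (X i) * \<theta> l - of_int (best i l))\<bar>)"
      by (rule sum_abs)
    also have "\<dots> \<le> (\<Sum>l=1..m. \<bar>of_int (c l)\<bar> * 1)"
      unfolding abs_mult
    proof (intro sum_mono mult_left_mono)
      fix l assume "l \<in> {1..m}"
      from best_err[OF this] approx_err_le_half[OF m_pos]
      show "\<bar>real (X i) * \<theta> l - of_int (best i l)\<bar> \<le> 1"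
        by (rule order_trans[OF order_trans]) simp
    qed simp
    finally have "real (X i) * \<bar>?S\<bar> \<le> ?K" by (simp add: abs_mult mult.commute)
    moreover have "real i * \<bar>?S\<bar> \<le> real (X i) * \<bar>?S\<bar>" using X_ge[of i] by (intro mult_right_mono) auto
    ultimately show ?thesis by linarith
  qed
  have "?S = 0"
  proof (rule ccontr)
    assume "?S \<noteq> 0"
    then obtain n where "?K < real n * \<bar>?S\<bar>" using reals_Archimedean3[of "\<bar>?S\<bar>"] by auto
    moreover have "real n * \<bar>?S\<bar> \<le> real (max n i0) * \<bar>?S\<bar>" by (intro mult_right_mono) auto
    ultimately show False using bound[of "max n i0"] by linarith
  qed
  then have "c 0 = 0 \<and> (\<forall>l\<in>{1..m}. c l = 0)" using irrational unfolding totally_irrational_def by blast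
  then show ?thesis by (auto simp: less_Suc_eq_0_disj)
qed

end

section \<open>Points on the sphere\<close>

context uniform_point
begin

lemma sphere_coord_le:
  assumes "(\<Sum>j=1..m. (\<theta> j)\<^sup>2) = 1" "l \<in> {1..m}"
  shows "\<bar>\<theta> l\<bar> \<le> 1"
proof -
  have "(\<theta> l)\<^sup>2 \<le> (\<Sum>j=1..m. (\<theta> j)\<^sup>2)" using assms(2) by (intro member_le_sum) auto
  then show ?thesis using assms(1) abs_le_square_iff[of "\<theta> l" 1] by simp
qed

text \<open>Since \<open>|A|\<^sup>2 = Q\<^sup>2\<close>, the positive integer \<open>|qA - Qa|\<^sup>2\<close> is divisible by \<open>Q\<close>, hence at least \<open>Q\<close>.\<close>

lemma sphere_gap:
  assumes on: "(\<Sum>l=1..m. (best (Suc i) l)\<^sup>2) = (best (Suc i) 0)\<^sup>2"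
  shows "1 \<le> 4 * real m * real (X (Suc i)) * (err (X i))\<^sup>2"
proof -
  define q Q where "q = int (X i)" and "Q = int (X (Suc i))"
  define a A where "a = best i" and "A = best (Suc i)"
  define N where "N = (\<Sum>l=1..m. (q * A l - Q * a l)\<^sup>2)"
  have qQ: "0 < q" "q < Q" using X_pos[of i] X_strict_mono[of i "Suc i"] by (auto simp: q_def Q_def)
  have "N = (\<Sum>l=1..m. q\<^sup>2 * (A l)\<^sup>2 - 2 * q * Q * (A l * a l) + Q\<^sup>2 * (a l)\<^sup>2)"
    unfolding N_def by (rule sum.cong) (auto simp: power2_eq_square algebra_simps)
  also have "\<dots> = q\<^sup>2 * (\<Sum>l=1..m. (A l)\<^sup>2) - 2 * q * Q * (\<Sum>l=1..m. A l * a l) + Q\<^sup>2 * (\<Sum>l=1..m. (a l)\<^sup>2)"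
    by (simp only: sum.distrib sum_subtractf sum_distrib_left)
  also have "\<dots> = Q * (q\<^sup>2 * Q - 2 * q * (\<Sum>l=1..m. A l * a l) + Q * (\<Sum>l=1..m. (a l)\<^sup>2))"
    using on by (simp add: A_def Q_def best_def power2_eq_square algebra_simps)
  finally have dvd: "Q dvd N" by simp
  \<comment> \<open>Otherwise the two vectors are proportional. In a coordinate attaining
    \<open>err (X i)\<close> this gives \<open>Q * err (X i) \<le> q * err (X (Suc i))\<close>,
    although \<open>q < Q\<close> and the errors decrease.\<close>
  have "N \<noteq> 0"
  proof
    assume "N = 0"
    then have eq: "q * A l = Q * a l" if "l \<in> {1..m}" for l
      using that by (simp add: N_def sum_nonneg_eq_0_iff)
    have "err (X i) \<in> (\<lambda>j. \<bar>real (X i) * \<theta> j - of_int (round (real (X i) * \<theta> j))\<bar>) ` {1..m}"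
      unfolding approx_err_def using m_pos by (intro Max_in) auto
    then obtain l where l: "l \<in> {1..m}" "err (X i) = \<bar>real (X i) * \<theta> l - of_int (a l)\<bar>"
      by (auto simp: a_def best_def)
    have "of_int q * (real (X (Suc i)) * \<theta> l - of_int (A l)) = of_int Q * (real (X i) * \<theta> l - of_int (a l))"
      using arg_cong[OF eq[OF l(1)], of real_of_int] by (simp add: q_def Q_def algebra_simps)
    from arg_cong[OF this, of abs] have "of_int Q * err (X i) = of_int q * \<bar>real (X (Suc i)) * \<theta> l - of_int (A l)\<bar>"
      unfolding l(2) using qQ by (simp add: abs_mult)
    also have "\<dots> \<le> of_int q * err (X (Suc i))"
      unfolding A_def using best_err[OF l(1)] qQ by (intro mult_left_mono) auto
    also have "\<dots> \<le> of_int q * err (X i)"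
      using err_X_less[of i "Suc i"] qQ by (intro mult_left_mono) auto
    finally show False using qQ err_X_pos[of i] by simp
  qed
  moreover have "0 \<le> N" by (auto simp: N_def intro: sum_nonneg)
  ultimately have "Q \<le> N" using dvd by (intro zdvd_imp_le) auto
  then have "real_of_int Q \<le> of_int N" by simp
  also have "\<dots> = (\<Sum>l=1..m. (of_int q * of_int (A l) - of_int Q * of_int (a l))\<^sup>2)"
    by (simp add: N_def)
  also have "\<dots> \<le> (\<Sum>l=1..m. (2 * of_int Q * err (X i))\<^sup>2)"
  proof (rule sum_mono)
    fix l assume l: "l \<in> {1..m}"
    have "of_int q * of_int (A l) - of_int Q * of_int (a l)
        = of_int Q * (real (X i) * \<theta> l - of_int (a l)) - of_int q * (real (X (Suc i)) * \<theta> l - of_int (A l))"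
      by (simp add: q_def Q_def algebra_simps)
    also have "\<bar>\<dots>\<bar> \<le> of_int Q * \<bar>real (X i) * \<theta> l - of_int (a l)\<bar> + of_int q * \<bar>real (X (Suc i)) * \<theta> l - of_int (A l)\<bar>"
      using qQ by (intro order_trans[OF abs_triangle_ineq4]) (simp add: abs_mult)
    also have "\<dots> \<le> of_int Q * err (X i) + of_int Q * err (X i)"
      using qQ best_err[OF l, of i] best_err[OF l, of "Suc i"] err_X_less[of i "Suc i"]
      unfolding a_def A_def by (intro add_mono mult_mono) auto
    finally have "\<bar>of_int q * of_int (A l) - of_int Q * of_int (a l)\<bar> \<le> \<bar>2 * of_int Q * err (X i)\<bar>" by linarith
    then show "(of_int q * of_int (A l) - of_int Q * of_int (a l))\<^sup>2 \<le> (2 * of_int Q * err (X i))\<^sup>2"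
      by (simp only: abs_le_square_iff)
  qed
  also have "\<dots> = of_int Q * (4 * real m * of_int Q * (err (X i))\<^sup>2)"
    by (simp add: power2_eq_square)
  finally show ?thesis using qQ by (simp add: Q_def)
qed

text \<open>Together with \<open>err_X_bound\<close>, \<open>sphere_gap\<close> would give
  \<open>1 \<le> C * X (Suc i) powr (1 - 2 * \<gamma>)\<close>, whose exponent is negative.\<close>

lemma eventually_off_sphere:
  assumes "1 / 2 < \<gamma>"
  shows "\<forall>\<^sub>F i in sequentially. (\<Sum>l=1..m. (best i l)\<^sup>2) \<noteq> (best i 0)\<^sup>2"
proof -
  define C where "C = 4 * real m * (2 powr \<gamma>)\<^sup>2"
  have "((\<lambda>i. C * real (X (Suc i)) powr (1 - 2 * \<gamma>)) \<longlongrightarrow> C * 0) sequentially"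
  proof (intro tendsto_mult tendsto_const tendsto_neg_powr)
    show "filterlim (\<lambda>i. real (X (Suc i))) at_top sequentially"
    proof (rule filterlim_at_top_mono[OF filterlim_real_sequentially], rule always_eventually, rule allI)
      fix i show "real i \<le> real (X (Suc i))" using X_ge[of "Suc i"] by linarith
    qed
  qed (use assms in simp)
  then have "\<forall>\<^sub>F i in sequentially. C * real (X (Suc i)) powr (1 - 2 * \<gamma>) < 1"
    by (rule order_tendstoD) simp
  with err_X_bound have "\<forall>\<^sub>F i in sequentially. (\<Sum>l=1..m. (best (Suc i) l)\<^sup>2) \<noteq> (best (Suc i) 0)\<^sup>2"
  proof eventually_elim
    case (elim i)
    let ?Q = "real (X (Suc i))"
    have Q: "0 < ?Q" using X_pos[of "Suc i"] by simp
    show ?case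
    proof
      assume "(\<Sum>l=1..m. (best (Suc i) l)\<^sup>2) = (best (Suc i) 0)\<^sup>2"
      then have "1 \<le> 4 * real m * ?Q * (err (X i))\<^sup>2" by (rule sphere_gap)
      also have "\<dots> \<le> 4 * real m * ?Q * (2 powr \<gamma> * ?Q powr (- \<gamma>))\<^sup>2"
        using elim(1) err_X_pos[of i] by (intro mult_left_mono power_mono) auto
      also have "\<dots> = C * (?Q powr 1 * (?Q powr (- \<gamma>) * ?Q powr (- \<gamma>)))"
        using Q by (simp add: C_def power2_eq_square)
      also have "\<dots> = C * ?Q powr (1 - 2 * \<gamma>)"
        unfolding powr_add[symmetric] by simp
      finally show False using elim(2) by simp
    qed
  qed
  then show ?thesis
    using eventually_sequentially_Suc[of "\<lambda>i. (\<Sum>l=1..m. (best i l)\<^sup>2) \<noteq> (best i 0)\<^sup>2"] by blast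
qed

text \<open>As \<open>\<theta>\<close> has norm 1, the nonzero integer
  \<open>q\<^sup>2 - |a|\<^sup>2\<close> is the sum of the products of
  \<open>q * \<theta> l - a l\<close> and \<open>q * \<theta> l + a l\<close>, of which the first
  factor is small.\<close>

lemma off_sphere_bound:
  assumes sphere: "(\<Sum>j=1..m. (\<theta> j)\<^sup>2) = 1"
    and off: "(\<Sum>l=1..m. (best i l)\<^sup>2) \<noteq> (best i 0)\<^sup>2"
  shows "1 \<le> 3 * real m * real (X i) * err (X i)"
proof -
  let ?q = "real (X i)"
  have "1 \<le> \<bar>(best i 0)\<^sup>2 - (\<Sum>l=1..m. (best i l)\<^sup>2)\<bar>" using off by linarith
  then have "1 \<le> \<bar>real_of_int ((best i 0)\<^sup>2 - (\<Sum>l=1..m. (best i l)\<^sup>2))\<bar>"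
    by (metis of_int_1_le_iff of_int_abs)
  also have "real_of_int ((best i 0)\<^sup>2 - (\<Sum>l=1..m. (best i l)\<^sup>2)) = ?q\<^sup>2 * (\<Sum>j=1..m. (\<theta> j)\<^sup>2) - (\<Sum>l=1..m. (of_int (best i l))\<^sup>2)"
    using sphere by (simp add: best_def)
  also have "\<dots> = (\<Sum>l=1..m. (?q * \<theta> l - of_int (best i l)) * (?q * \<theta> l + of_int (best i l)))"
    unfolding sum_distrib_left sum_subtractf[symmetric]
    by (rule sum.cong) (auto simp: power2_eq_square algebra_simps)
  also have "\<bar>\<dots>\<bar> \<le> (\<Sum>l=1..m. \<bar>(?q * \<theta> l - of_int (best i l)) * (?q * \<theta> l + of_int (best i l))\<bar>)"
    by (rule sum_abs)
  also have "\<dots> \<le> (\<Sum>l=1..m. err (X i) * (3 * ?q))"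
    unfolding abs_mult
  proof (intro sum_mono mult_mono)
    fix l assume l: "l \<in> {1..m}"
    show "\<bar>?q * \<theta> l - of_int (best i l)\<bar> \<le> err (X i)" by (rule best_err[OF l])
    have "\<bar>?q * \<theta> l\<bar> \<le> ?q * 1"
      unfolding abs_mult using sphere_coord_le[OF sphere l] by (intro mult_mono) auto
    \<comment> \<open>The sum is at most \<open>2 * ?q + 1 / 2\<close> in absolute value, and
      \<open>1 \<le> ?q\<close>.\<close>
    then show "\<bar>?q * \<theta> l + of_int (best i l)\<bar> \<le> 3 * ?q"
      using best_err[OF l, of i] approx_err_le_half[OF m_pos, of \<theta> "X i"] X_pos[of i] by linarith
  qed (use err_X_pos[of i] in auto)
  finally show ?thesis by (simp add: mult_ac)
qed

text \<open>The lower bound of \<open>off_sphere_bound\<close> is set against the upper bound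
  \<open>err_X_bound\<close> for the same error, and logarithms are taken.\<close>

lemma growth_bound:
  assumes sphere: "(\<Sum>j=1..m. (\<theta> j)\<^sup>2) = 1" and "1 / 2 < \<gamma>"
  shows "\<forall>\<^sub>F i in sequentially.
    \<gamma> * ln (real (X (Suc i))) \<le> ln (real (X i)) + ln (3 * real m * 2 powr \<gamma>)"
  using err_X_bound eventually_off_sphere[OF assms(2)]
proof eventually_elim
  case (elim i)
  have pos: "0 < real (X i)" "0 < real (X (Suc i))" "0 < real m"
    using X_pos[of i] X_pos[of "Suc i"] m_pos by auto
  have "1 \<le> 3 * real m * real (X i) * err (X i)" by (rule off_sphere_bound[OF sphere elim(2)])
  also have "\<dots> \<le> 3 * real m * real (X i) * (2 powr \<gamma> * real (X (Suc i)) powr (- \<gamma>))"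
    using elim(1) by (intro mult_left_mono) auto
  also have "\<dots> = (3 * real m * 2 powr \<gamma>) * real (X i) * real (X (Suc i)) powr (- \<gamma>)" by simp
  finally have "0 \<le> ln (\<dots>)" by simp
  also have "\<dots> = ln (3 * real m * 2 powr \<gamma>) + ln (real (X i)) - \<gamma> * ln (real (X (Suc i)))"
    using pos by (subst ln_mult_pos ; simp add: ln_mult_pos ln_powr)
  finally show ?case by simp
qed

text \<open>This is the logarithm of the determinant bound for a chain starting at
  \<open>best s\<close>. The \<open>j\<close>-th new vector is \<open>best (Suc (k j))\<close> and
  its predecessor \<open>best (k j)\<close> lies in the old span.\<close>

lemma chain_inequality:
  assumes bound: "\<And>i. s \<le> i \<Longrightarrow> err (X i) \<le> C * real (X (Suc i)) powr (- \<gamma>)" and "0 < C"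
    and \<theta>_le: "\<And>l. l \<in> {1..m} \<Longrightarrow> \<bar>\<theta> l\<bar> \<le> 1"
  obtains k where "\<And>j. j < m \<Longrightarrow> s \<le> k j" "\<And>j. Suc j < m \<Longrightarrow> k j < k (Suc j)"
    "(\<Sum>j<m. ln (real (X (k j)))) \<le> ln (real (X s)) + (1 - \<gamma>) * (\<Sum>j<m. ln (real (X (Suc (k j)))))
       + (ln (2 * fact (Suc m)) + real m * ln (2 * C))"
proof -
  have "\<exists>M. M 0 = s \<and> (\<forall>j<m. M j < M (Suc j) \<and>
      \<not> in_span (Suc m) (best \<circ> M) j (best (M (Suc j))) \<and>
      in_span (Suc m) (best \<circ> M) j (best (M (Suc j) - 1)))"
  proof (rule span_chain_exists)
    show "\<forall>l<Suc m. c l = 0" if "\<forall>i\<ge>i0. (\<Sum>l<Suc m. c l * best i l) = 0" for c i0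
      using that by (rule best_spanning)
  qed simp
  then obtain M where M0: "M 0 = s" and M: "\<And>j. j < m \<Longrightarrow> M j < M (Suc j) \<and>
      \<not> in_span (Suc m) (best \<circ> M) j (best (M (Suc j))) \<and>
      in_span (Suc m) (best \<circ> M) j (best (M (Suc j) - 1))"
    by blast
  define k where "k j = M (Suc j) - 1" for j
  have MS: "M (Suc j) = Suc (k j)" "M j \<le> k j" if "j < m" for j
    using M[OF that] by (auto simp: k_def)
  have sM: "s \<le> M j" if "j \<le> m" for j
    using that by (induction j) (use M0 M in \<open>auto dest!: Suc_le_lessD intro: less_imp_le order_trans\<close>)
  have sk: "s \<le> k j" if "j < m" for j using sM[of j] MS[of j] that by simp
  have kk: "k j < k (Suc j)" if "Suc j < m" for j using MS(1)[of j] MS(2)[of "Suc j"] that by simp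
  have pos: "0 < real (X i)" for i using X_pos[of i] by simp
  \<comment> \<open>With this multiplier, subtracting \<open>r j\<close> times
    \<open>best (k j)\<close> makes coordinate 0 of the new row vanish.\<close>
  define r where "r j = real (X (Suc (k j))) / real (X (k j))" for j
  have r: "1 \<le> r j" for j
    unfolding r_def using X_mono[of "k j" "Suc (k j)"] pos[of "k j"] by simp
  have term_pos: "0 < 2 * r j * err (X (k j))" for j
    using r[of j] err_X_pos[of "k j"] by (simp add: less_le_trans[OF zero_less_one])
  \<comment> \<open>In row 0, rounding adds at most 1/2 to \<open>X s\<close>. In the others,
    \<open>r j * err (X (k j))\<close> also dominates the error of the new vector, as
    \<open>1 \<le> r j\<close>. Both give the factor 2.\<close>
  define B where "B i = (case i of 0 \<Rightarrow> 2 * real (X s) | Suc j \<Rightarrow> 2 * r j * err (X (k j)))" for i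
  have "1 \<le> fact (Suc m) * (\<Prod>i<Suc m. B i)"
  proof (rule chain_det_bound[where v = "best \<circ> M" and u = "\<lambda>j. best (k j)" and t = r])
    show "\<exists>l\<le>m. (best \<circ> M) 0 l \<noteq> 0"
      using pos[of s] by (intro exI[of _ 0]) (simp add: best_def M0)
    show "\<not> in_span (Suc m) (best \<circ> M) j ((best \<circ> M) (Suc j))" if "j < m" for j
      using M[OF that] by simp
    show "in_span (Suc m) (best \<circ> M) j (best (k j))" if "j < m" for j
      using M[OF that] by (simp add: k_def)
    show "\<bar>real_of_int ((best \<circ> M) 0 l)\<bar> \<le> B 0" if "l \<le> m" for l
    proof (cases "l = 0")
      case True
      then show ?thesis by (simp add: B_def M0 best_def)
    next
      case False
      then have l: "l \<in> {1..m}" using that by simp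
      have "\<bar>real (X s) * \<theta> l\<bar> \<le> real (X s) * 1"
        unfolding abs_mult using \<theta>_le[OF l] by (intro mult_mono) auto
      then show ?thesis
        using best_err[OF l, of s] approx_err_le_half[OF m_pos, of \<theta> "X s"] X_pos[of s]
        by (simp add: B_def M0)
    qed
    show "\<bar>real_of_int ((best \<circ> M) (Suc j) l) - r j * real_of_int (best (k j) l)\<bar> \<le> B (Suc j)"
      if j: "j < m" and "l \<le> m" for j l
    proof (cases "l = 0")
      case True
      then show ?thesis
        using MS(1)[OF j] pos[of "k j"] r[of j] err_X_pos[of "k j"] by (simp add: B_def best_def r_def)
    next
      case False
      then have l: "l \<in> {1..m}" using that by simp
      let ?i = "Suc (k j)"
      have "real_of_int (best ?i l) - r j * real_of_int (best (k j) l)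
          = r j * (real (X (k j)) * \<theta> l - of_int (best (k j) l)) - (real (X ?i) * \<theta> l - of_int (best ?i l))"
        using pos[of "k j"] by (simp add: r_def field_simps)
      also have "\<bar>\<dots>\<bar> \<le> \<bar>r j * (real (X (k j)) * \<theta> l - of_int (best (k j) l))\<bar> + \<bar>real (X ?i) * \<theta> l - of_int (best ?i l)\<bar>"
        by (rule abs_triangle_ineq4)
      also have "\<dots> \<le> r j * err (X (k j)) + 1 * err (X ?i)"
        using best_err[OF l, of "k j"] best_err[OF l, of ?i] r[of j]
        unfolding abs_mult by (intro add_mono mult_mono) auto
      also have "\<dots> \<le> r j * err (X (k j)) + r j * err (X (k j))"
        using r[of j] err_X_less[of "k j" ?i] err_X_pos[of ?i] by (intro add_left_mono mult_mono) auto
      finally show ?thesis using MS(1)[OF j] by (simp add: B_def)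
    qed
  qed
  also have "(\<Prod>i<Suc m. B i) = 2 * real (X s) * (\<Prod>j<m. 2 * r j * err (X (k j)))"
    by (subst prod.lessThan_Suc_shift) (simp add: B_def)
  also have "fact (Suc m) * \<dots> = (2 * fact (Suc m)) * real (X s) * (\<Prod>j<m. 2 * r j * err (X (k j)))"
    by simp
  finally have "0 \<le> ln (\<dots>)" by simp
  also have "\<dots> = ln (2 * fact (Suc m)) + ln (real (X s)) + ln (\<Prod>j<m. 2 * r j * err (X (k j)))"
  proof -
    have "0 < (\<Prod>j<m. 2 * r j * err (X (k j)))" using term_pos by (intro prod_pos) auto
    then show ?thesis using pos[of s] by (simp only: ln_mult_pos mult_pos_pos zero_less_numeral fact_gt_zero)
  qed
  also have "ln (\<Prod>j<m. 2 * r j * err (X (k j))) = (\<Sum>j<m. ln (2 * r j * err (X (k j))))"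
    using less_imp_neq[OF term_pos, THEN not_sym] by (intro ln_prod) blast+
  also have "\<dots> \<le> (\<Sum>j<m. ln (2 * C) + (1 - \<gamma>) * ln (real (X (Suc (k j)))) - ln (real (X (k j))))"
  proof (rule sum_mono)
    fix j assume "j \<in> {..<m}"
    then have "s \<le> k j" using sk by simp
    have rp: "0 < r j" using r[of j] by simp
    have "2 * r j * err (X (k j)) \<le> 2 * r j * (C * real (X (Suc (k j))) powr (- \<gamma>))"
      using bound[OF \<open>s \<le> k j\<close>] rp by (intro mult_left_mono) auto
    then have "ln (2 * r j * err (X (k j))) \<le> ln ((2 * C) * (real (X (Suc (k j))) powr (- \<gamma>) * r j))"
      using term_pos[of j] by (intro ln_mono) (simp_all only: mult_ac)
    also have "\<dots> = ln (2 * C) + (ln (real (X (Suc (k j))) powr (- \<gamma>)) + ln (r j))"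
      using rp pos[of "Suc (k j)"] \<open>0 < C\<close> by (simp only: ln_mult_pos mult_pos_pos zero_less_numeral powr_gt_zero)
    also have "\<dots> = ln (2 * C) + (1 - \<gamma>) * ln (real (X (Suc (k j)))) - ln (real (X (k j)))"
      using pos by (simp add: r_def ln_div ln_powr algebra_simps)
    finally show "ln (2 * r j * err (X (k j))) \<le> \<dots>" .
  qed
  also have "\<dots> = real m * ln (2 * C) + (1 - \<gamma>) * (\<Sum>j<m. ln (real (X (Suc (k j))))) - (\<Sum>j<m. ln (real (X (k j))))"
    by (simp add: sum.distrib sum_subtractf sum_distrib_left)
  finally show ?thesis using that[of k] sk kk by (simp add: algebra_simps)
qed

text \<open>For every late start \<open>s\<close>, \<open>weighted_chain_bound\<close> bounds the
  sum of the logarithms by a constant free of \<open>s\<close>, but this sum is at least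
  \<open>ln s\<close>.\<close>

lemma sphere_contradiction:
  assumes sphere: "(\<Sum>j=1..m. (\<theta> j)\<^sup>2) = 1" and "2 \<le> m" "\<gamma> < 1"
    and large: "1 < (\<Sum>k=1..m. \<gamma> ^ k)"
  shows False
proof -
  obtain n where n: "m = Suc n" "0 < n" using \<open>2 \<le> m\<close> by (cases m) auto
  have sum_eq: "(\<Sum>k=1..m. \<gamma> ^ k) = (\<Sum>k<m. \<gamma> ^ Suc k)"
    by (rule sum.reindex_bij_witness[of _ Suc "\<lambda>k. k - 1"]) auto
  have "1 / 2 < \<gamma>"
  proof (rule ccontr)
    assume "\<not> ?thesis"
    \<comment> \<open>For \<open>\<gamma> \<le> 1 / 2\<close> comparison with the geometric series
      keeps the sum below 1.\<close>
    then have "(\<Sum>k<m. \<gamma> ^ Suc k) \<le> (\<Sum>k<m. (1 / 2) ^ Suc k)"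
      using \<gamma>_pos by (intro sum_mono power_mono) auto
    also have "(\<Sum>k<m. (1 / 2 :: real) ^ Suc k) = 1 - (1 / 2) ^ m" by (induction m) auto
    also have "\<dots> < 1" by simp
    finally show False using large sum_eq by simp
  qed
  define C where "C = (2 :: real) powr \<gamma>"
  \<comment> \<open>One constant for both the growth bound and the determinant bound.\<close>
  define D where "D = max (ln (3 * real m * C)) (ln (2 * fact (Suc m)) + real m * ln (2 * C))"
  define T where "T j = (\<Sum>k<j. \<gamma> ^ Suc k)" for j
  define K where "K = (1 - \<gamma>) * (\<Sum>j<Suc n. T j / \<gamma> * D) + T n * D"
  have T: "0 < T (Suc n) - 1" using large sum_eq n by (simp add: T_def)
  have "\<forall>\<^sub>F s in sequentially. (T (Suc n) - 1) * ln (real s) \<le> K"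
    using eventually_all_ge_at_top[OF err_X_bound]
      eventually_all_ge_at_top[OF growth_bound[OF sphere \<open>1 / 2 < \<gamma>\<close>]] eventually_ge_at_top[of 1]
  proof eventually_elim
    case (elim s)
    obtain k where k: "\<And>j. j < m \<Longrightarrow> s \<le> k j" "\<And>j. Suc j < m \<Longrightarrow> k j < k (Suc j)"
      and sum: "(\<Sum>j<m. ln (real (X (k j)))) \<le> ln (real (X s)) + (1 - \<gamma>) * (\<Sum>j<m. ln (real (X (Suc (k j)))))
       + (ln (2 * fact (Suc m)) + real m * ln (2 * C))"
      using chain_inequality[of s C] elim(1) sphere_coord_le[OF sphere] unfolding C_def by auto
    have ln_X_mono: "ln (real (X i)) \<le> ln (real (X j))" if "i \<le> j" for i j
      using X_mono[OF that] X_pos[of i] X_pos[of j] by simp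
    define y where "y j = ln (real (X (k j)))" for j
    define z where "z j = ln (real (X (Suc (k j))))" for j
    have "(T (Suc n) - 1) * (\<Sum>j<n. y (Suc j)) \<le> K"
      unfolding K_def T_def
    proof (rule weighted_chain_bound[where z = z])
      show "z j \<le> y (Suc j)" if "j < n" for j
        using k(2)[of j] that n unfolding z_def y_def by (intro ln_X_mono) simp
      show "\<gamma> * z j \<le> y j + D" if "j \<le> n" for j
        using elim(2)[rule_format, OF k(1)[of j]] that n unfolding z_def y_def D_def C_def by simp
      \<comment> \<open>The contribution of the initial row is absorbed by \<open>y 0\<close>, which
        leaves the sum over \<open>y (Suc j)\<close>.\<close>
      have "ln (real (X s)) \<le> y 0" unfolding y_def using k(1)[of 0] n by (intro ln_X_mono) simp
      moreover have "(\<Sum>j<m. ln (real (X (k j)))) = y 0 + (\<Sum>j<n. y (Suc j))"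
        unfolding n(1) y_def by (subst sum.lessThan_Suc_shift) simp
      ultimately show "(\<Sum>j<n. y (Suc j)) \<le> (1 - \<gamma>) * (\<Sum>j<Suc n. z j) + D"
        using sum unfolding D_def z_def n(1) by linarith
    qed (use \<gamma>_pos \<open>\<gamma> < 1\<close> in auto)
    moreover have "ln (real s) \<le> (\<Sum>j<n. y (Suc j))"
    proof -
      have y0: "0 \<le> y j" for j unfolding y_def using X_pos[of "k j"] by simp
      have "real s \<le> real (X (k 1))" using X_ge[of s] X_mono[OF k(1)[of 1]] \<open>2 \<le> m\<close> by simp
      then have "ln (real s) \<le> y (Suc 0)" using elim(3) by (simp add: y_def)
      also have "\<dots> \<le> (\<Sum>j<n. y (Suc j))"
        using n(2) y0 by (intro member_le_sum[of 0 "{..<n}" "\<lambda>j. y (Suc j)"]) auto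
      finally show ?thesis .
    qed
    ultimately show ?case using T by (meson mult_left_mono less_imp_le order_trans)
  qed
  moreover have "\<forall>\<^sub>F s in sequentially. K / (T (Suc n) - 1) < ln (real s)"
    using filterlim_compose[OF ln_at_top filterlim_real_sequentially] by (simp add: filterlim_at_top_dense)
  ultimately have "\<forall>\<^sub>F s :: nat in sequentially. False"
    by eventually_elim (use T in \<open>simp add: field_simps\<close>)
  then show False by simp
qed

end

theorem theorem2:
  fixes d :: nat and \<xi> :: "nat \<Rightarrow> real"
  assumes "d \<ge> 2"
    and "totally_irrational d \<xi>"
    and "(\<Sum>j=1..d. (\<xi> j)\<^sup>2) = 1"
  shows "uniform_exponent d \<xi> \<le> ereal (H (d - 1))"
  unfolding uniform_exponent_def
proof (rule SUP_least)
  fix \<gamma> assume "\<gamma> \<in> {\<gamma>. uniformly_approximable d \<xi> \<gamma>}"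
  then have unif: "uniformly_approximable d \<xi> \<gamma>" by simp
  let ?h = "H (d - 1)"
  have h: "0 < ?h" "(\<Sum>k=1..d. ?h ^ k) = 1" using H_root[of "d - 1"] \<open>d \<ge> 2\<close> by auto
  have "?h < 1"
  proof (rule ccontr)
    assume "\<not> ?h < 1"
    then have "(\<Sum>k=1..d. 1) \<le> (\<Sum>k=1..d. ?h ^ k)" by (intro sum_mono) simp
    then show False using h(2) \<open>d \<ge> 2\<close> by simp
  qed
  have "\<gamma> \<le> ?h"
  proof (rule ccontr)
    assume "\<not> \<gamma> \<le> ?h"
    \<comment> \<open>An admissible exponent may be lowered, and \<open>sphere_contradiction\<close>
      requires one below 1.\<close>
    then obtain \<gamma>' where \<gamma>': "?h < \<gamma>'" "\<gamma>' < min \<gamma> 1"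
      using dense[of ?h "min \<gamma> 1"] \<open>?h < 1\<close> by auto
    interpret uniform_point d \<xi> \<gamma>'
      by unfold_locales (use assms h(1) \<gamma>' uniformly_approximable_mono[OF unif] in auto)
    have "(\<Sum>k=1..d. ?h ^ k) < (\<Sum>k=1..d. \<gamma>' ^ k)"
      using h(1) \<gamma>' \<open>d \<ge> 2\<close> by (intro sum_strict_mono power_strict_mono) auto
    then show False using sphere_contradiction assms \<gamma>' h(2) by simp
  qed
  then show "ereal \<gamma> \<le> ereal ?h" by simp
qed

end
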